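(* Let $r\ge1$ and let $a_1,\dots,a_r$ be nonzero complex numbers. For every integer $n\ge0$, $$\frac{d}{dx}D_n(x|a_1,\dots,a_r)=n!\sum_{l=0}^{n-1}\frac{(-1)^{n-l-1}}{l!(n-l)}D_l(x|a_1,\dots,a_r),\qquad \frac{d}{dx}\widehat D_n(x|a_1,\dots,a_r)=n!\sum_{l=0}^{n-1}\frac{(-1)^{n-l-1}}{l!(n-l)}\widehat D_l(x|a_1,\dots,a_r).$$
   Context: For nonzero complex $a_1,\dots,a_r$, the Barnes-type Daehee polynomials of the first and second kind are defined by the formal power series identities $\prod_{j=1}^r\frac{\ln(1+t)}{(1+t)^{a_j}-1}(1+t)^x=\sum_{n\ge0}D_n(x|a_1,\dots,a_r)\frac{t^n}{n!}$ and $\prod_{j=1}^r\frac{(1+t)^{a_j}\ln(1+t)}{(1+t)^{a_j}-1}(1+t)^x=\sum_{n\ge0}\widehat D_n(x|a_1,\dots,a_r)\frac{t^n}{n!}$. An empty sum is $0$. *)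

theory Defs
  imports Complex_Main "HOL-Computational_Algebra.Formal_Power_Series"
begin

text \<open>
  As formal power series in \<open>t = fps_X\<close>, \<open>fps_ln 1\<close> is \<open>ln (1 + t)\<close> and \<open>fps_binomial b\<close> is
  \<open>(1 + t) ^ b\<close> for complex \<open>b\<close>. The series \<open>fps_binomial b - 1\<close> is not invertible, but for
  \<open>b \<noteq> 0\<close> it has subdegree 1 and divides \<open>fps_ln 1\<close>, so the divisions below are exact
  (lemma \<open>daehee_quotient\<close>).
  The parameters are \<open>a 1, \<dots>, a r\<close>; other values of \<open>a\<close> are irrelevant.
\<close>

definition daehee1_gf :: "nat \<Rightarrow> (nat \<Rightarrow> complex) \<Rightarrow> complex \<Rightarrow> complex fps" where
  "daehee1_gf r a x =
     (\<Prod>j=1..r. fps_ln 1 / (fps_binomial (a j) - 1)) * fps_binomial x"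

definition daehee2_gf :: "nat \<Rightarrow> (nat \<Rightarrow> complex) \<Rightarrow> complex \<Rightarrow> complex fps" where
  "daehee2_gf r a x =
     (\<Prod>j=1..r. (fps_binomial (a j) * fps_ln 1) / (fps_binomial (a j) - 1)) * fps_binomial x"

definition daehee1 :: "nat \<Rightarrow> (nat \<Rightarrow> complex) \<Rightarrow> nat \<Rightarrow> complex \<Rightarrow> complex" where
  "daehee1 r a n x = fact n * fps_nth (daehee1_gf r a x) n"

definition daehee2 :: "nat \<Rightarrow> (nat \<Rightarrow> complex) \<Rightarrow> nat \<Rightarrow> complex \<Rightarrow> complex" where
  "daehee2 r a n x = fact n * fps_nth (daehee2_gf r a x) n"

lemma daehee1_egf: "daehee1_gf r a x = Abs_fps (\<lambda>n. daehee1 r a n x / fact n)"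
  by (simp add: fps_eq_iff daehee1_def)

lemma daehee2_egf: "daehee2_gf r a x = Abs_fps (\<lambda>n. daehee2 r a n x / fact n)"
  by (simp add: fps_eq_iff daehee2_def)

lemma daehee_quotient:
  fixes b :: complex
  assumes "b \<noteq> 0"
  shows "fps_binomial b - 1 dvd fps_ln 1"
    and "fps_ln 1 / (fps_binomial b - 1) * (fps_binomial b - 1) = fps_ln 1"
    and "fps_binomial b * fps_ln 1 / (fps_binomial b - 1) * (fps_binomial b - 1) =
           fps_binomial b * fps_ln 1"
proof -
  have nz1: "fps_nth (fps_binomial b - 1) 1 \<noteq> 0"
    using assms by simp
  have nz: "fps_binomial b - 1 \<noteq> 0"
  proof
    assume "fps_binomial b - 1 = 0"
    with nz1 show False by (metis fps_zero_nth)
  qed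
  have ln1: "fps_nth (fps_ln (1::complex)) 1 \<noteq> 0"
    by (simp add: fps_ln_nth)
  have lnnz: "fps_ln (1::complex) \<noteq> 0"
  proof
    assume "fps_ln (1::complex) = 0"
    with ln1 show False by (metis fps_zero_nth)
  qed
  have "subdegree (fps_binomial b - 1) \<le> 1"
    using nz1 by (rule subdegree_leI)
  moreover have "subdegree (fps_ln (1::complex)) \<ge> 1"
    using lnnz by (intro subdegree_geI) auto
  ultimately show dvd: "fps_binomial b - 1 dvd fps_ln 1"
    using nz lnnz by (subst fps_dvd_iff) auto
  show "fps_ln 1 / (fps_binomial b - 1) * (fps_binomial b - 1) = fps_ln 1"
    using dvd by (rule dvd_div_mult_self)
  show "fps_binomial b * fps_ln 1 / (fps_binomial b - 1) * (fps_binomial b - 1) =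
          fps_binomial b * fps_ln 1"
    using dvd by (intro dvd_div_mult_self dvd_mult)
qed

end

theory Submission
  imports Defs
begin

text \<open>
  Both generating functions have the form \<open>F * fps_binomial x\<close> with \<open>F\<close> independent of \<open>x\<close>.
  Since \<open>fps_binomial x = fps_binomial x\<^sub>0 * fps_binomial (x - x\<^sub>0)\<close>, differentiating
  the coefficients at \<open>x\<^sub>0\<close> only requires the derivative of \<open>h gchoose n\<close> at \<open>h = 0\<close>, which
  is the \<open>n\<close>-th coefficient of \<open>ln (1 + t)\<close>.
\<close>

lemma gbinomial_minus_one: "(-1 :: 'a::field_char_0) gchoose n = (-1) ^ n"
  using gbinomial_minus[of "1 :: 'a" n] by (simp flip: binomial_gbinomial)

text \<open>For \<open>n = Suc m\<close>, absorption splits off a factor \<open>h\<close>; the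
  derivative at 0 is the value there of the cofactor \<open>g\<close>, by Caratheodory's
  criterion.\<close>

lemma has_field_derivative_gbinomial_0:
  "((\<lambda>h :: 'a::real_normed_field. h gchoose n) has_field_derivative fps_nth (fps_ln 1) n) (at 0)"
proof (cases n)
  case (Suc m)
  define g :: "'a \<Rightarrow> 'a" where "g h = ((h - 1) gchoose m) / of_nat (Suc m)" for h
  have "h gchoose n = g h * h" for h
    unfolding g_def Suc using gbinomial_absorption[of m h]
    by (simp add: field_simps del: of_nat_Suc)
  moreover have "isCont g 0"
    unfolding g_def gbinomial_prod_rev
    by (intro continuous_intros) (simp_all del: of_nat_Suc)
  moreover have "g 0 = fps_nth (fps_ln 1) n"
    by (simp add: g_def gbinomial_minus_one fps_ln_nth Suc)
  ultimately show ?thesis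
    unfolding CARAT_DERIV by (intro exI[of _ g]) simp
qed simp

lemma has_field_derivative_fps_nth_mult_binomial:
  "((\<lambda>x. fps_nth (F * fps_binomial x) n) has_field_derivative
      fps_nth (F * fps_binomial x * fps_ln 1) n) (at (x :: 'a::real_normed_field))"
proof -
  have "F * fps_binomial y = F * fps_binomial x * fps_binomial (y - x)" for y
    using fps_binomial_add_mult[of x "y - x"] by (simp add: mult.assoc)
  then have "(\<lambda>y. fps_nth (F * fps_binomial y) n) =
      (\<lambda>y. \<Sum>i=0..n. fps_nth (F * fps_binomial x) i * ((y - x) gchoose (n - i)))"
    by (metis (no_types, lifting) fps_mult_nth fps_binomial_nth sum.cong)
  moreover have "((\<lambda>y. (y - x) gchoose k) has_field_derivative fps_nth (fps_ln 1) k) (at x)" for k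
    using DERIV_shift[of "\<lambda>h. h gchoose k" "fps_nth (fps_ln 1) k" x "-x"]
    by (simp add: has_field_derivative_gbinomial_0)
  \<comment> \<open>Only the binomial factors depend on \<open>y\<close>, so the termwise derivative
    is again a Cauchy product, now with \<open>fps_ln 1\<close>.\<close>
  ultimately show ?thesis
    by (auto simp: fps_mult_nth[of _ "fps_ln 1"] intro!: DERIV_sum DERIV_cmult)
qed

text \<open>The constant coefficient of \<open>fps_ln 1\<close> is 0, which removes the term
  \<open>l = n\<close> of the Cauchy product.\<close>

lemma fps_nth_mult_ln:
  "fps_nth (G * fps_ln (1 :: 'a::field_char_0)) n =
     (\<Sum>l=0..<n. (-1) ^ (n - l - 1) / of_nat (n - l) * fps_nth G l)"
  by (simp add: fps_mult_nth fps_ln_nth atLeast0LessThan atLeast0AtMost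
      lessThan_Suc_atMost[symmetric] ac_simps)

theorem theorem5:
  fixes r n :: nat and a :: "nat \<Rightarrow> complex" and x :: complex
  assumes "r \<ge> 1"
    and "\<And>j. j \<in> {1..r} \<Longrightarrow> a j \<noteq> 0"
  shows "(daehee1 r a n has_field_derivative
           fact n * (\<Sum>l=0..<n. (-1) ^ (n - l - 1) / (fact l * of_nat (n - l)) * daehee1 r a l x)) (at x) \<and>
         (daehee2 r a n has_field_derivative
           fact n * (\<Sum>l=0..<n. (-1) ^ (n - l - 1) / (fact l * of_nat (n - l)) * daehee2 r a l x)) (at x)"
proof -
  \<comment> \<open>With \<open>F\<close> arbitrary, both kinds are covered at once; the two
    \<open>fact l\<close> cancel.\<close>
  have *: "((\<lambda>x. fact n * fps_nth (F * fps_binomial x) n) has_field_derivative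
      fact n * (\<Sum>l=0..<n. (-1) ^ (n - l - 1) / (fact l * of_nat (n - l)) *
        (fact l * fps_nth (F * fps_binomial x) l))) (at x)" for F
    using DERIV_cmult[OF has_field_derivative_fps_nth_mult_binomial[of F n x], of "fact n"]
    by (simp add: fps_nth_mult_ln)
  show ?thesis
    unfolding daehee1_def[abs_def] daehee2_def[abs_def] daehee1_gf_def daehee2_gf_def
    using * by blast
qed

end
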